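(* Assume Conjecture (T) (stated in the context). Let $p\ge 1$, let $D(x_1,\ldots,x_p)\in\mathbb{Z}[x_1,\ldots,x_p]$, and let $$\widehat{D}(x_1,a_1,b_1,c_1,d_1,\ldots,x_p,a_p,b_p,c_p,d_p)=D(x_1,\ldots,x_p)^2+\sum_{i=1}^{p}\bigl(x_i-a_i^2-b_i^2-c_i^2-d_i^2\bigr)^2,$$ a polynomial with integer coefficients in $5p$ variables. If the equation $D(x_1,\ldots,x_p)=0$ has only finitely many solutions in non-negative integers, then each such solution $(x_1,\ldots,x_p)$ satisfies $x_1,\ldots,x_p\le \mathrm{bound}(\widehat{D})$.
   Context: For a positive integer $n$, let $E_n=\{x_i=1,\ x_i+x_j=x_k,\ x_i\cdot x_j=x_k:\ i,j,k\in\{1,\ldots,n\}\}$ be the set of all formal equations of these forms in the variables $x_1,\ldots,x_n$ (indices may coincide). A system $S\subseteq E_n$ is solved by a tuple if the tuple satisfies every equation in $S$. Conjecture (T) is the statement: for each positive integer $n$, if a system $S\subseteq E_n$ has only finitely many solutions in integers $x_1,\ldots,x_n$, then each such solution satisfies $|x_1|,\ldots,|x_n|\le 2^{2^{n-1}}$. For a polynomial $F(u_1,\ldots,u_r)$ with integer coefficients, let $M$ be the maximum of the absolute values of the coefficients of $F$ and let $e_i$ be the degree of $F$ with respect to $u_i$; define $$\mathrm{bound}(F)=2^{2^{(2M+1)^{(e_1+1)\cdots(e_r+1)}-1}}.$$ *)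

theory Defs
  imports Complex_Main "HOL-Library.Poly_Mapping" "HOL-Library.FuncSet"
begin

text \<open>
  Polynomials with integer coefficients in variables indexed by natural numbers: a monomial
  assigns an exponent to each variable, a polynomial assigns a coefficient to each monomial,
  both with finite support.  Multiplication is the convolution product of
  \<^theory>\<open>HOL-Library.Poly_Mapping\<close>.
\<close>

type_synonym int_mpoly = "(nat \<Rightarrow>\<^sub>0 nat) \<Rightarrow>\<^sub>0 int"

definition Var :: "nat \<Rightarrow> int_mpoly" where
  "Var i = Poly_Mapping.single (Poly_Mapping.single i 1) 1"

definition vars :: "int_mpoly \<Rightarrow> nat set" where
  "vars F = (\<Union>m\<in>Poly_Mapping.keys F. Poly_Mapping.keys m)"

text \<open>
  Evaluation in an arbitrary commutative ring; taking the ring to be the polynomials themselves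
  gives substitution.
\<close>

definition mpoly_eval :: "(nat \<Rightarrow> 'a::comm_ring_1) \<Rightarrow> int_mpoly \<Rightarrow> 'a" where
  "mpoly_eval x F =
    (\<Sum>m\<in>Poly_Mapping.keys F. of_int (Poly_Mapping.lookup F m) *
      (\<Prod>i\<in>Poly_Mapping.keys m. x i ^ Poly_Mapping.lookup m i))"

text \<open>
  The inserted \<open>0\<close> only matters for the zero polynomial, whose height and degrees are \<open>0\<close>.
\<close>

definition height :: "int_mpoly \<Rightarrow> nat" where
  "height F = Max (insert 0 ((\<lambda>m. nat \<bar>Poly_Mapping.lookup F m\<bar>) ` Poly_Mapping.keys F))"

definition degree_in :: "nat \<Rightarrow> int_mpoly \<Rightarrow> nat" where
  "degree_in i F = Max (insert 0 ((\<lambda>m. Poly_Mapping.lookup m i) ` Poly_Mapping.keys F))"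

text \<open>The bound for a polynomial regarded as a polynomial in the variables \<open>1, \<dots>, r\<close>.\<close>

definition bound :: "nat \<Rightarrow> int_mpoly \<Rightarrow> nat" where
  "bound r F = 2 ^ (2 ^ ((2 * height F + 1) ^ (\<Prod>i=1..r. degree_in i F + 1) - 1))"

text \<open>
  The variables \<open>x\<^sub>i, a\<^sub>i, b\<^sub>i, c\<^sub>i, d\<^sub>i\<close> (\<open>1 \<le> i \<le> p\<close>), in this order, are numbered
  \<open>5 i - 4, \<dots>, 5 i\<close>, so that together they are exactly the variables \<open>1, \<dots>, 5 p\<close>.
\<close>

definition D_hat :: "nat \<Rightarrow> int_mpoly \<Rightarrow> int_mpoly" where
  "D_hat p D =
    (mpoly_eval (\<lambda>i. Var (5 * i - 4)) D) ^ 2 +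
    (\<Sum>i=1..p. (Var (5 * i - 4) - Var (5 * i - 3) ^ 2 - Var (5 * i - 2) ^ 2
                 - Var (5 * i - 1) ^ 2 - Var (5 * i) ^ 2) ^ 2)"

text \<open>
  \<open>One i\<close>, \<open>Add i j k\<close>, \<open>Mul i j k\<close> stand for the formal equations
  \<open>x\<^sub>i = 1\<close>, \<open>x\<^sub>i + x\<^sub>j = x\<^sub>k\<close>, \<open>x\<^sub>i \<cdot> x\<^sub>j = x\<^sub>k\<close>.
\<close>

datatype equation = One nat | Add nat nat nat | Mul nat nat nat

definition E :: "nat \<Rightarrow> equation set" where
  "E n = {One i |i. i \<in> {1..n}} \<union>
         {Add i j k |i j k. i \<in> {1..n} \<and> j \<in> {1..n} \<and> k \<in> {1..n}} \<union>
         {Mul i j k |i j k. i \<in> {1..n} \<and> j \<in> {1..n} \<and> k \<in> {1..n}}"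

fun satisfies :: "(nat \<Rightarrow> int) \<Rightarrow> equation \<Rightarrow> bool" where
  "satisfies x (One i) \<longleftrightarrow> x i = 1"
| "satisfies x (Add i j k) \<longleftrightarrow> x i + x j = x k"
| "satisfies x (Mul i j k) \<longleftrightarrow> x i * x j = x k"

text \<open>
  An \<open>n\<close>-tuple is an extensional function on \<open>{1..n}\<close>, so that counting functions is
  counting tuples.
\<close>

definition solutions :: "nat \<Rightarrow> equation set \<Rightarrow> (nat \<Rightarrow> int) set" where
  "solutions n S = {x \<in> {1..n} \<rightarrow>\<^sub>E UNIV. \<forall>e\<in>S. satisfies x e}"

definition conjecture_T :: bool where
  "conjecture_T \<longleftrightarrow>
    (\<forall>n\<ge>1. \<forall>S\<subseteq>E n. finite (solutions n S) \<longrightarrow>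
      (\<forall>x\<in>solutions n S. \<forall>i\<in>{1..n}. \<bar>x i\<bar> \<le> 2 ^ (2 ^ (n - 1))))"

definition nonneg_zeros :: "nat \<Rightarrow> int_mpoly \<Rightarrow> (nat \<Rightarrow> int) set" where
  "nonneg_zeros p D = {x \<in> {1..p} \<rightarrow>\<^sub>E {0..}. mpoly_eval x D = 0}"

end

theory Submission
  imports Defs "HOL-Computational_Algebra.Primes"
begin

text \<open>
  The main step concerns integer zeros of a polynomial \<open>F\<close> in \<open>r\<close>
  variables with finitely many of them (\<open>integer_zeros_bounded\<close>). Every variable then
  occurs in \<open>F\<close>, provided there is a zero at all. Let \<open>M\<close> be the height of
  \<open>F\<close> and \<open>e\<^sub>1, \<dots>, e\<^sub>r\<close> its degrees, and consider all
  polynomials whose height and degrees do not exceed those of \<open>F\<close>. There are at most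
  \<open>n = (2 M + 1) ^ ((e\<^sub>1 + 1) \<cdots> (e\<^sub>r + 1))\<close> of them. Give each its
  own unknown, and write down every equation \<open>G + H = K\<close> and
  \<open>G \<cdot> H = K\<close> that holds among these polynomials, together with the value \<open>1\<close> for the
  polynomial \<open>1\<close> and \<open>F = 0\<close>. Since each of them can be built up from the
  variables by additions and multiplications without leaving the set, a solution of the system is
  nothing but the evaluation of all the polynomials at a point
  (\<open>partial_hom_eq_mpoly_eval\<close>), and this point is a zero of \<open>F\<close>. So
  solutions correspond bijectively to integer zeros of \<open>F\<close>, and the conjecture, applied
  to at most \<open>n\<close> unknowns, bounds the zeros by \<open>2 ^ (2 ^ (n - 1))\<close>.

  The integer zeros of \<open>D_hat p D\<close> are the zeros of \<open>D\<close> together with a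
  representation of each coordinate as a sum of four squares. Such a coordinate is non-negative and
  has finitely many representations, so finiteness carries over
  (\<open>finite_integer_zeros_D_hat\<close>), and by Lagrange's theorem
  (\<open>lagrange_four_squares\<close>) every non-negative zero of \<open>D\<close> arises in this
  way (\<open>nonneg_zero_lifts_to_D_hat\<close>).
\<close>

section \<open>Lagrange's four-square theorem\<close>

definition sum_of_four_squares :: "int \<Rightarrow> bool" where
  "sum_of_four_squares n \<longleftrightarrow> (\<exists>a b c d. n = a\<^sup>2 + b\<^sup>2 + c\<^sup>2 + d\<^sup>2)"

lemma euler_four_squares:
  fixes a b c d w x y z :: int
  shows "(a\<^sup>2 + b\<^sup>2 + c\<^sup>2 + d\<^sup>2) * (w\<^sup>2 + x\<^sup>2 + y\<^sup>2 + z\<^sup>2) =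
    (a * w + b * x + c * y + d * z)\<^sup>2 + (a * x - b * w + c * z - d * y)\<^sup>2 +
    (a * y - b * z - c * w + d * x)\<^sup>2 + (a * z + b * y - c * x - d * w)\<^sup>2"
  by algebra

lemma sum_of_four_squares_mult:
  assumes "sum_of_four_squares m" "sum_of_four_squares n"
  shows "sum_of_four_squares (m * n)"
proof -
  obtain a b c d w x y z where "m = a\<^sup>2 + b\<^sup>2 + c\<^sup>2 + d\<^sup>2" "n = w\<^sup>2 + x\<^sup>2 + y\<^sup>2 + z\<^sup>2"
    using assms unfolding sum_of_four_squares_def by blast
  then show ?thesis
    unfolding sum_of_four_squares_def using euler_four_squares[of a b c d w x y z] by blast
qed

text \<open>
  Residues of absolute value at most \<open>m / 2\<close>: the sum of four of their squares is at most \<open>m\<^sup>2\<close>,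
  which is what makes the descent below go down.
\<close>

lemma symmetric_residue:
  fixes a m :: int
  assumes "m > 0"
  obtains r k where "a = r + m * k" "2 * \<bar>r\<bar> \<le> m"
proof (cases "2 * (a mod m) \<le> m")
  case True
  have "a = a mod m + m * (a div m)" by simp
  moreover have "2 * \<bar>a mod m\<bar> \<le> m" using True assms by simp
  ultimately show ?thesis using that by blast
next
  case False
  have "a = (a mod m - m) + m * (a div m + 1)" by (simp add: algebra_simps)
  moreover have "2 * \<bar>a mod m - m\<bar> \<le> m"
    using False pos_mod_bound[OF assms, of a] by (simp add: abs_if)
  ultimately show ?thesis using that by blast
qed

text \<open>
  Euler's descent. Replace \<open>a, b, c, d\<close> by their symmetric residues \<open>w, x, y, z\<close> modulo \<open>m\<close>. The sum of
  squares of the residues is again a multiple \<open>m r\<close> of \<open>m\<close>, with \<open>r \<le> m\<close>. In Euler's identity for the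
  product \<open>m p \<cdot> m r\<close> all four entries are divisible by \<open>m\<close>, so dividing by \<open>m\<^sup>2\<close> leaves \<open>r p\<close>.
\<close>

lemma four_squares_descent:
  fixes m p :: int
  assumes "prime p" "1 < m" "m < p" "sum_of_four_squares (m * p)"
  shows "\<exists>r. 0 < r \<and> r < m \<and> sum_of_four_squares (r * p)"
proof -
  have m: "m > 0" using assms by simp
  obtain a b c d where mp: "m * p = a\<^sup>2 + b\<^sup>2 + c\<^sup>2 + d\<^sup>2"
    using assms(4) unfolding sum_of_four_squares_def by blast
  obtain w a' where w: "a = w + m * a'" "2 * \<bar>w\<bar> \<le> m" using symmetric_residue[OF m] .
  obtain x b' where x: "b = x + m * b'" "2 * \<bar>x\<bar> \<le> m" using symmetric_residue[OF m] .
  obtain y c' where y: "c = y + m * c'" "2 * \<bar>y\<bar> \<le> m" using symmetric_residue[OF m] .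
  obtain z d' where z: "d = z + m * d'" "2 * \<bar>z\<bar> \<le> m" using symmetric_residue[OF m] .
  define N where "N = w\<^sup>2 + x\<^sup>2 + y\<^sup>2 + z\<^sup>2"
  have expand: "m * p = N + m * (2 * w * a' + 2 * x * b' + 2 * y * c' + 2 * z * d')
      + m * m * (a'\<^sup>2 + b'\<^sup>2 + c'\<^sup>2 + d'\<^sup>2)"
    unfolding mp N_def w(1) x(1) y(1) z(1) by algebra
  have "N = m * (p - (2 * w * a' + 2 * x * b' + 2 * y * c' + 2 * z * d')
      - m * (a'\<^sup>2 + b'\<^sup>2 + c'\<^sup>2 + d'\<^sup>2))"
    using expand by (simp add: algebra_simps)
  then obtain r where r: "N = m * r" by blast
  have sq: "4 * t\<^sup>2 \<le> m\<^sup>2" if "2 * \<bar>t\<bar> \<le> m" for t :: int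
  proof -
    have "(2 * \<bar>t\<bar>)\<^sup>2 \<le> m\<^sup>2" using that by (intro power_mono) auto
    then show ?thesis by (simp add: power_mult_distrib)
  qed
  note le = sq[OF w(2)] sq[OF x(2)] sq[OF y(2)] sq[OF z(2)]
  have "m * r \<le> m * m" using le unfolding r[symmetric] N_def by (simp add: power2_eq_square)
  then have "r \<le> m" using m by simp
  have "m * r \<ge> 0" unfolding r[symmetric] N_def by simp
  then have "r \<ge> 0" using m by (simp add: zero_le_mult_iff)
  \<comment> \<open>The extreme cases \<open>r = 0\<close>, with all residues \<open>0\<close>, and \<open>r = m\<close>, with all residues \<open>m / 2\<close> in
    absolute value, are excluded together: in both, \<open>m\<^sup>2\<close> would divide \<open>m p\<close>.\<close>
  have no: False if dv: "m dvd r" "m dvd 2 * w" "m dvd 2 * x" "m dvd 2 * y" "m dvd 2 * z"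
  proof -
    have "p = r + (2 * w * a' + 2 * x * b' + 2 * y * c' + 2 * z * d')
        + m * (a'\<^sup>2 + b'\<^sup>2 + c'\<^sup>2 + d'\<^sup>2)"
    proof -
      have "m * p = m * (r + (2 * w * a' + 2 * x * b' + 2 * y * c' + 2 * z * d')
        + m * (a'\<^sup>2 + b'\<^sup>2 + c'\<^sup>2 + d'\<^sup>2))"
        using expand r by (simp add: algebra_simps)
      then show ?thesis using m by simp
    qed
    moreover have "m dvd r + (2 * w * a' + 2 * x * b' + 2 * y * c' + 2 * z * d')
        + m * (a'\<^sup>2 + b'\<^sup>2 + c'\<^sup>2 + d'\<^sup>2)"
      using dv by (intro dvd_add dvd_mult2[of m "2 * _"] dvd_triv_left)
    ultimately have "m dvd p" by simp
    then have "m = 1 \<or> m = p" using assms(1) m unfolding prime_int_iff by simp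
    then show False using assms by simp
  qed
  have "r \<noteq> 0"
  proof
    assume "r = 0"
    then have "w\<^sup>2 + x\<^sup>2 + y\<^sup>2 + z\<^sup>2 = 0" using r unfolding N_def by simp
    then have "w\<^sup>2 = 0" "x\<^sup>2 = 0" "y\<^sup>2 = 0" "z\<^sup>2 = 0"
      using zero_le_power2[of w] zero_le_power2[of x] zero_le_power2[of y] zero_le_power2[of z]
      by linarith+
    then have "w = 0" "x = 0" "y = 0" "z = 0" by simp_all
    then show False using no \<open>r = 0\<close> by simp
  qed
  moreover have "r \<noteq> m"
  proof
    assume "r = m"
    then have "4 * (w\<^sup>2 + x\<^sup>2 + y\<^sup>2 + z\<^sup>2) = 4 * m\<^sup>2"
      using r unfolding N_def by (simp add: power2_eq_square)
    then have "4 * w\<^sup>2 \<ge> m\<^sup>2" "4 * x\<^sup>2 \<ge> m\<^sup>2" "4 * y\<^sup>2 \<ge> m\<^sup>2" "4 * z\<^sup>2 \<ge> m\<^sup>2"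
      using le unfolding distrib_left by linarith+
    then have eq: "4 * w\<^sup>2 = m\<^sup>2" "4 * x\<^sup>2 = m\<^sup>2" "4 * y\<^sup>2 = m\<^sup>2" "4 * z\<^sup>2 = m\<^sup>2"
      using le by (auto intro: antisym)
    have "m dvd 2 * t" if "4 * t\<^sup>2 = m\<^sup>2" for t
    proof -
      have "(2 * t)\<^sup>2 = m\<^sup>2" using that by (simp add: power_mult_distrib)
      then have "2 * t = m \<or> 2 * t = - m" unfolding power2_eq_iff .
      then show ?thesis by (metis dvd_refl dvd_minus_iff)
    qed
    then show False using no eq \<open>r = m\<close> by simp
  qed
  moreover have "sum_of_four_squares (r * p)"
  proof -
    define A where "A = r + (a' * w + b' * x + c' * y + d' * z)"
    define B where "B = a' * x - b' * w + c' * z - d' * y"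
    define C where "C = a' * y - b' * z - c' * w + d' * x"
    define D where "D = a' * z + b' * y - c' * x - d' * w"
    have 1: "a * w + b * x + c * y + d * z = m * A"
    proof -
      have "a * w + b * x + c * y + d * z = N + m * (a' * w + b' * x + c' * y + d' * z)"
        unfolding w(1) x(1) y(1) z(1) N_def by algebra
      then show ?thesis unfolding r A_def by (simp add: algebra_simps)
    qed
    have 2: "a * x - b * w + c * z - d * y = m * B"
      "a * y - b * z - c * w + d * x = m * C" "a * z + b * y - c * x - d * w = m * D"
      unfolding w(1) x(1) y(1) z(1) B_def C_def D_def by algebra+
    have "m * p * (m * r) = (m * A)\<^sup>2 + (m * B)\<^sup>2 + (m * C)\<^sup>2 + (m * D)\<^sup>2"
      using euler_four_squares[of a b c d w x y z] unfolding 1 2 mp[symmetric] N_def[symmetric] r .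
    then have "m\<^sup>2 * (r * p) = m\<^sup>2 * (A\<^sup>2 + B\<^sup>2 + C\<^sup>2 + D\<^sup>2)"
      by (simp add: algebra_simps power2_eq_square)
    then have "r * p = A\<^sup>2 + B\<^sup>2 + C\<^sup>2 + D\<^sup>2" using m by simp
    then show ?thesis unfolding sum_of_four_squares_def by blast
  qed
  ultimately show ?thesis using \<open>r \<ge> 0\<close> \<open>r \<le> m\<close> by (intro exI[of _ r]) auto
qed

text \<open>
  Among \<open>0, \<dots>, (p - 1) / 2\<close> the squares are distinct modulo \<open>p\<close>, and so are the numbers \<open>- 1 - y\<^sup>2\<close>.
  These are \<open>p + 1\<close> residues, so one of the first kind equals one of the second.
\<close>

lemma odd_prime_dvd_sum_two_squares_plus_one:
  fixes p :: int
  assumes "prime p" "odd p"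
  obtains x y where "0 \<le> x" "2 * x < p" "0 \<le> y" "2 * y < p" "p dvd x\<^sup>2 + y\<^sup>2 + 1"
proof -
  have p: "p > 1" using assms(1) prime_gt_1_int by blast
  define I where "I = {0..p div 2}"
  define f where "f x = x\<^sup>2 mod p" for x
  define g where "g y = (- 1 - y\<^sup>2) mod p" for y
  obtain h where h: "p = 2 * h + 1" using assms(2) by (rule oddE)
  have I: "I = {0..h}" unfolding I_def h by simp
  have half: "2 * x < p" if "x \<in> I" for x using that unfolding I h by simp
  have nonneg: "0 \<le> x" if "x \<in> I" for x using that unfolding I_def by auto
  have eqI: "x = y" if "x \<in> I" "y \<in> I" "p dvd x\<^sup>2 - y\<^sup>2" for x y
  proof -
    have "p dvd (x - y) * (x + y)" using that(3) by (simp add: power2_eq_square algebra_simps)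
    then have "p dvd x - y \<or> p dvd x + y" using assms(1) prime_dvd_mult_iff by blast
    moreover have "\<bar>x - y\<bar> < p" "\<bar>x + y\<bar> < p"
      using half[OF that(1)] half[OF that(2)] nonneg[OF that(1)] nonneg[OF that(2)]
      unfolding abs_less_iff by auto
    moreover have "t = 0" if "p dvd t" "\<bar>t\<bar> < p" for t
    proof (rule ccontr)
      assume "t \<noteq> 0"
      then have "\<bar>p\<bar> \<le> \<bar>t\<bar>" using that(1) by (rule dvd_imp_le_int)
      then show False using that(2) p by simp
    qed
    ultimately have "x - y = 0 \<or> x + y = 0" by blast
    then show ?thesis using nonneg[OF that(1)] nonneg[OF that(2)] by linarith
  qed
  have injf: "inj_on f I"
  proof (rule inj_onI)
    fix x y assume "x \<in> I" "y \<in> I" "f x = f y"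
    then show "x = y" using eqI by (simp only: f_def mod_eq_dvd_iff)
  qed
  have injg: "inj_on g I"
  proof (rule inj_onI)
    fix x y assume "x \<in> I" "y \<in> I" "g x = g y"
    then have "p dvd (- 1 - x\<^sup>2) - (- 1 - y\<^sup>2)" by (simp only: g_def mod_eq_dvd_iff)
    then have "p dvd y\<^sup>2 - x\<^sup>2" by simp
    then show "x = y" using eqI[OF \<open>y \<in> I\<close> \<open>x \<in> I\<close>] by simp
  qed
  have cI: "2 * int (card I) = p + 1" using p unfolding I h by simp
  have "f ` I \<inter> g ` I \<noteq> {}"
  proof
    assume "f ` I \<inter> g ` I = {}"
    then have "card (f ` I \<union> g ` I) = card I + card I"
      by (subst card_Un_disjoint) (auto simp: I_def card_image injf[unfolded I_def] injg[unfolded I_def])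
    moreover have "f ` I \<union> g ` I \<subseteq> {0..<p}" using p by (auto simp: f_def g_def)
    then have "card (f ` I \<union> g ` I) \<le> card {0..<p}" by (intro card_mono) auto
    ultimately have "card I + card I \<le> nat p" by simp
    then show False using cI p by linarith
  qed
  then obtain x y where xy: "x \<in> I" "y \<in> I" "f x = g y" by blast
  then have "p dvd x\<^sup>2 - (- 1 - y\<^sup>2)" by (simp only: f_def g_def mod_eq_dvd_iff)
  then have "p dvd x\<^sup>2 + y\<^sup>2 + 1" by (simp add: algebra_simps)
  then show ?thesis using that[OF nonneg[OF xy(1)] half[OF xy(1)] nonneg[OF xy(2)] half[OF xy(2)]] by blast
qed

text \<open>
  The multiple \<open>x\<^sup>2 + y\<^sup>2 + 1\<close> of an odd prime \<open>p\<close> starts the descent: since \<open>x\<close> and \<open>y\<close> are below \<open>p / 2\<close>,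
  its cofactor \<open>m\<close> is less than \<open>p\<close>.
\<close>

lemma prime_sum_of_four_squares:
  fixes p :: int
  assumes "prime p"
  shows "sum_of_four_squares p"
proof (cases "p = 2")
  case True
  then have "p = 1\<^sup>2 + 1\<^sup>2 + 0\<^sup>2 + 0\<^sup>2" by simp
  then show ?thesis unfolding sum_of_four_squares_def by blast
next
  case False
  then have "odd p" using assms prime_odd_int prime_ge_2_int[OF assms] by force
  then obtain x y where xy: "0 \<le> x" "2 * x < p" "0 \<le> y" "2 * y < p" "p dvd x\<^sup>2 + y\<^sup>2 + 1"
    using odd_prime_dvd_sum_two_squares_plus_one[OF assms] by metis
  have p: "p > 1" using assms prime_gt_1_int by blast
  obtain m where m: "x\<^sup>2 + y\<^sup>2 + 1 = m * p" using xy(5) by (metis dvdE mult.commute)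
  have descend: "sum_of_four_squares p"
    if "0 < k" "k < p" "sum_of_four_squares (k * p)" for k
    using that
  proof (induction "nat k" arbitrary: k rule: less_induct)
    case less
    show ?case
    proof (cases "k = 1")
      case True
      then show ?thesis using less by simp
    next
      case False
      then obtain r where "0 < r" "r < k" "sum_of_four_squares (r * p)"
        using four_squares_descent[OF assms, of k] less by auto
      then show ?thesis using less by auto
    qed
  qed
  have "m * p > 0" 
    unfolding m[symmetric] using zero_le_power2[of x] zero_le_power2[of y] by linarith
  then have "m > 0" using p by (simp add: zero_less_mult_iff)
  moreover have "m < p"
  proof -
    have "(2 * x)\<^sup>2 \<le> (p - 1)\<^sup>2" "(2 * y)\<^sup>2 \<le> (p - 1)\<^sup>2" using xy by (intro power_mono; simp)+
    then have "4 * (x\<^sup>2 + y\<^sup>2 + 1) \<le> 2 * (p - 1)\<^sup>2 + 4" by (simp add: power_mult_distrib)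
    also have "\<dots> = 4 * p\<^sup>2 - (2 * p * (p - 1) + 6 * (p - 1))"
      by (simp add: power2_eq_square algebra_simps)
    also have "\<dots> < 4 * p\<^sup>2"
    proof -
      have "2 * p * (p - 1) + 6 * (p - 1) > 0" using p by (intro add_pos_pos mult_pos_pos) auto
      then show ?thesis by simp
    qed
    finally have "m * p < p * p" unfolding m by (simp add: power2_eq_square)
    then show ?thesis using p by simp
  qed
  moreover have "m * p = x\<^sup>2 + y\<^sup>2 + 1\<^sup>2 + 0\<^sup>2" using m by simp
  then have "sum_of_four_squares (m * p)" unfolding sum_of_four_squares_def by blast
  ultimately show ?thesis by (rule descend)
qed

theorem lagrange_four_squares:
  fixes n :: int
  assumes "n \<ge> 0"
  shows "sum_of_four_squares n"
  using assms
proof (induction "nat n" arbitrary: n rule: less_induct)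
  case less
  consider "n = 0" | "n = 1" | "n > 1" using less.prems by linarith
  then show ?case
  proof cases
    case 1
    then have "n = 0\<^sup>2 + 0\<^sup>2 + 0\<^sup>2 + 0\<^sup>2" by simp
    then show ?thesis unfolding sum_of_four_squares_def by blast
  next
    case 2
    then have "n = 1\<^sup>2 + 0\<^sup>2 + 0\<^sup>2 + 0\<^sup>2" by simp
    then show ?thesis unfolding sum_of_four_squares_def by blast
  next
    case 3
    then obtain q where q: "prime q" "q dvd n" using prime_factor_int[of n] by auto
    then obtain k where k: "n = q * k" by blast
    have "q > 1" using q prime_gt_1_int by blast
    have "k > 0" using 3 zero_less_mult_pos[of q k] \<open>q > 1\<close> unfolding k by linarith
    then have "k < n" using k \<open>q > 1\<close> by simp
    then have "sum_of_four_squares k" using less.hyps[of k] \<open>k > 0\<close> by simp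
    then show ?thesis unfolding k
      by (intro sum_of_four_squares_mult[OF prime_sum_of_four_squares[OF q(1)]])
  qed
qed

section \<open>Evaluation is a ring homomorphism\<close>

text \<open>
  Adding one monomial at a time, each outside the current support, passes only through
  polynomials whose coefficients are coefficients of the final one. This is why an induction of
  this shape can be carried out inside a set of polynomials of bounded height and degrees;
  it is used in the same way for monomials, which are finite maps from variables to exponents.
\<close>

lemma poly_mapping_induct_disjoint [case_names zero add]:
  fixes f :: "'a \<Rightarrow>\<^sub>0 'b::monoid_add"
  assumes "P 0"
    and "\<And>f k v. k \<notin> Poly_Mapping.keys f \<Longrightarrow> v \<noteq> 0 \<Longrightarrow> P f \<Longrightarrow> P (f + Poly_Mapping.single k v)"
  shows "P f"
proof (induction f rule: Poly_Mapping.update_induct)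
  case const
  show ?case by (fact assms(1))
next
  case (update f k v)
  have "Poly_Mapping.update k v f = f + Poly_Mapping.single k v"
    using update(1)
    by (intro poly_mapping_eqI) (auto simp: lookup_update lookup_add lookup_single in_keys_iff when_def)
  then show ?case using assms(2)[OF update(1,2,3)] by simp
qed

lemma keys_add_single_disjoint:
  fixes f :: "'a \<Rightarrow>\<^sub>0 'b::monoid_add"
  assumes "k \<notin> Poly_Mapping.keys f" "v \<noteq> 0"
  shows "Poly_Mapping.keys (f + Poly_Mapping.single k v) = insert k (Poly_Mapping.keys f)"
  using assms by (auto simp: in_keys_iff lookup_add lookup_single when_def split: if_splits)

lemma lookup_add_single_disjoint:
  fixes f :: "'a \<Rightarrow>\<^sub>0 'b::monoid_add"
  assumes "k \<notin> Poly_Mapping.keys f"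
  shows "Poly_Mapping.lookup (f + Poly_Mapping.single k v) l =
    (if l = k then v else Poly_Mapping.lookup f l)"
  using assms by (auto simp: in_keys_iff lookup_add lookup_single when_def)

definition monom_eval :: "(nat \<Rightarrow> 'a::comm_ring_1) \<Rightarrow> (nat \<Rightarrow>\<^sub>0 nat) \<Rightarrow> 'a" where
  "monom_eval x m = (\<Prod>i\<in>Poly_Mapping.keys m. x i ^ Poly_Mapping.lookup m i)"

lemma mpoly_eval_monom_eval:
  "mpoly_eval x F = (\<Sum>m\<in>Poly_Mapping.keys F. of_int (Poly_Mapping.lookup F m) * monom_eval x m)"
  unfolding mpoly_eval_def monom_eval_def ..

lemma monom_eval_add: "monom_eval x (m + n) = monom_eval x m * monom_eval x n"
proof -
  let ?A = "Poly_Mapping.keys m \<union> Poly_Mapping.keys n"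
  have *: "monom_eval x k = (\<Prod>i\<in>?A. x i ^ Poly_Mapping.lookup k i)"
    if "Poly_Mapping.keys k \<subseteq> ?A" for k
    unfolding monom_eval_def using that
    by (intro prod.mono_neutral_left) (auto simp: in_keys_iff)
  show ?thesis
    by (simp add: * keys_add lookup_add power_add prod.distrib)
qed

lemma monom_eval_single: "monom_eval x (Poly_Mapping.single i n) = x i ^ n"
  by (simp add: monom_eval_def)

lemma mpoly_eval_single: "mpoly_eval x (Poly_Mapping.single m c) = of_int c * monom_eval x m"
  by (simp add: mpoly_eval_monom_eval)

lemma mpoly_eval_add: "mpoly_eval x (F + G) = mpoly_eval x F + mpoly_eval x G"
  unfolding mpoly_eval_monom_eval
  by (rule setsum_keys_plus_distrib) (auto simp: algebra_simps)

lemma mpoly_eval_0 [simp]: "mpoly_eval x 0 = 0"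
  by (simp add: mpoly_eval_def)

lemma mpoly_eval_of_int [simp]: "mpoly_eval x (of_int c) = of_int c"
  by (simp add: mpoly_eval_single monom_eval_def single_of_int[symmetric] del: single_of_int)

lemma mpoly_eval_1 [simp]: "mpoly_eval x 1 = 1"
  using mpoly_eval_of_int[of x 1] by simp

lemma mpoly_eval_Var [simp]: "mpoly_eval x (Var i) = x i"
  by (simp add: Var_def mpoly_eval_single monom_eval_def)

lemma mpoly_eval_mult: "mpoly_eval x (F * G) = mpoly_eval x F * mpoly_eval x G"
proof (induction F rule: poly_mapping_induct_disjoint)
  case zero
  show ?case by simp
next
  case (add F m c)
  have "mpoly_eval x (Poly_Mapping.single m c * G) =
      mpoly_eval x (Poly_Mapping.single m c) * mpoly_eval x G"
    by (induction G rule: poly_mapping_induct_disjoint)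
      (simp_all add: distrib_left mpoly_eval_add mpoly_eval_single mult_single monom_eval_add algebra_simps)
  then show ?case using add.IH by (simp add: distrib_right mpoly_eval_add)
qed

lemma mpoly_eval_diff: "mpoly_eval x (F - G) = mpoly_eval x F - mpoly_eval x G"
  using mpoly_eval_add[of x "F - G" G] by simp

lemma mpoly_eval_power: "mpoly_eval x (F ^ n) = mpoly_eval x F ^ n"
  by (induction n) (simp_all add: mpoly_eval_mult)

lemma mpoly_eval_sum: "mpoly_eval x (\<Sum>i\<in>A. f i) = (\<Sum>i\<in>A. mpoly_eval x (f i))"
  by (induction A rule: infinite_finite_induct) (simp_all add: mpoly_eval_add)

lemma mpoly_eval_prod: "mpoly_eval x (\<Prod>i\<in>A. f i) = (\<Prod>i\<in>A. mpoly_eval x (f i))"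
  by (induction A rule: infinite_finite_induct) (simp_all add: mpoly_eval_mult)

text \<open>
  Evaluation at polynomials is substitution, so this says that evaluation after substitution is
  evaluation at the values of the substituted polynomials: a ring homomorphism commutes with
  the polynomial expression that defines \<^const>\<open>mpoly_eval\<close>.
\<close>

lemma mpoly_eval_substitute:
  "mpoly_eval x (mpoly_eval g F) = mpoly_eval (\<lambda>i. mpoly_eval x (g i)) F"
proof -
  have "mpoly_eval x (mpoly_eval g F) = (\<Sum>m\<in>Poly_Mapping.keys F. of_int (Poly_Mapping.lookup F m) *
      (\<Prod>i\<in>Poly_Mapping.keys m. mpoly_eval x (g i) ^ Poly_Mapping.lookup m i))"
    unfolding mpoly_eval_def[of g]
    by (simp add: mpoly_eval_sum mpoly_eval_mult mpoly_eval_prod mpoly_eval_power)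
  then show ?thesis by (simp add: mpoly_eval_def)
qed

lemma mpoly_eval_cong:
  assumes "\<And>i. i \<in> vars F \<Longrightarrow> x i = y i"
  shows "mpoly_eval x F = mpoly_eval y F"
proof -
  have "x i = y i" if "m \<in> Poly_Mapping.keys F" "i \<in> Poly_Mapping.keys m" for m i
    using that by (intro assms) (auto simp: vars_def)
  then show ?thesis unfolding mpoly_eval_def by simp
qed

section \<open>Variables of a polynomial\<close>

lemma vars_add: "vars (F + G) \<subseteq> vars F \<union> vars G"
  unfolding vars_def using keys_add[of F G] by blast

lemma vars_diff: "vars (F - G) \<subseteq> vars F \<union> vars G"
proof -
  have "Poly_Mapping.keys (F - G) \<subseteq> Poly_Mapping.keys F \<union> Poly_Mapping.keys G"
    by (auto simp: in_keys_iff lookup_minus)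
  then show ?thesis unfolding vars_def by blast
qed

lemma vars_mult: "vars (F * G) \<subseteq> vars F \<union> vars G"
proof -
  have "Poly_Mapping.keys m \<subseteq> vars F \<union> vars G" if "m \<in> Poly_Mapping.keys (F * G)" for m
  proof -
    obtain a b where "m = a + b" "a \<in> Poly_Mapping.keys F" "b \<in> Poly_Mapping.keys G"
      using \<open>m \<in> Poly_Mapping.keys (F * G)\<close> keys_mult[of F G] by blast
    then show ?thesis unfolding vars_def using keys_add[of a b] by blast
  qed
  then show ?thesis unfolding vars_def[of "F * G"] by blast
qed

lemma vars_of_int [simp]: "vars (of_int c) = {}"
  unfolding vars_def by (simp add: single_of_int[symmetric] del: single_of_int)

lemma vars_0 [simp]: "vars 0 = {}" and vars_1 [simp]: "vars 1 = {}"
  unfolding vars_def by simp_all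

lemma vars_Var [simp]: "vars (Var i) = {i}"
  unfolding vars_def Var_def by simp

lemma vars_power: "vars (F ^ n) \<subseteq> vars F"
  by (induction n) (use vars_mult in fastforce)+

lemma vars_sum: "vars (\<Sum>i\<in>A. f i) \<subseteq> (\<Union>i\<in>A. vars (f i))"
  by (induction A rule: infinite_finite_induct) (use vars_add in fastforce)+

lemma vars_prod: "vars (\<Prod>i\<in>A. f i) \<subseteq> (\<Union>i\<in>A. vars (f i))"
  by (induction A rule: infinite_finite_induct) (use vars_mult in fastforce)+

lemma vars_substitute: "vars (mpoly_eval g F) \<subseteq> (\<Union>i\<in>vars F. vars (g i))"
proof -
  have "vars (of_int (Poly_Mapping.lookup F m) * (\<Prod>i\<in>Poly_Mapping.keys m. g i ^ Poly_Mapping.lookup m i))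
      \<subseteq> (\<Union>i\<in>vars F. vars (g i))" if "m \<in> Poly_Mapping.keys F" for m
  proof -
    have "vars (\<Prod>i\<in>Poly_Mapping.keys m. g i ^ Poly_Mapping.lookup m i)
        \<subseteq> (\<Union>i\<in>Poly_Mapping.keys m. vars (g i))"
      by (rule order_trans[OF vars_prod]) (intro UN_mono order_refl vars_power)
    also have "\<dots> \<subseteq> (\<Union>i\<in>vars F. vars (g i))" using that unfolding vars_def[of F] by blast
    finally show ?thesis using vars_mult by fastforce
  qed
  then show ?thesis unfolding mpoly_eval_def by (intro order_trans[OF vars_sum] UN_least)
qed

section \<open>Polynomials of bounded height and degrees\<close>

definition monoms_in_box :: "nat set \<Rightarrow> (nat \<Rightarrow> nat) \<Rightarrow> (nat \<Rightarrow>\<^sub>0 nat) set" where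
  "monoms_in_box V e = {m. Poly_Mapping.keys m \<subseteq> V \<and> (\<forall>i\<in>V. Poly_Mapping.lookup m i \<le> e i)}"

definition polys_in_box :: "nat set \<Rightarrow> (nat \<Rightarrow> nat) \<Rightarrow> nat \<Rightarrow> int_mpoly set" where
  "polys_in_box V e M = {F. Poly_Mapping.keys F \<subseteq> monoms_in_box V e \<and>
     (\<forall>m\<in>monoms_in_box V e. \<bar>Poly_Mapping.lookup F m\<bar> \<le> int M)}"

text \<open>
  A finite map supported in \<open>A\<close> is determined by its restriction to \<open>A\<close>, so there are at most as
  many as choices of a value at each point. Monomials are counted this way with exponents as
  values, and then polynomials with monomials as points and coefficients as values; together
  this yields the iterated exponents inside \<^const>\<open>bound\<close>.
\<close>

lemma poly_mapping_box_card:
  fixes B :: "'a \<Rightarrow> 'b::zero set"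
  assumes "finite A" "\<And>k. k \<in> A \<Longrightarrow> finite (B k)"
    and T: "T \<subseteq> {f. Poly_Mapping.keys f \<subseteq> A \<and> (\<forall>k\<in>A. Poly_Mapping.lookup f k \<in> B k)}"
  shows "finite T" "card T \<le> (\<Prod>k\<in>A. card (B k))"
proof -
  let ?\<phi> = "\<lambda>f. restrict (Poly_Mapping.lookup f) A"
  have inj: "inj_on ?\<phi> T"
  proof (rule inj_onI)
    fix f g assume fg: "f \<in> T" "g \<in> T" "?\<phi> f = ?\<phi> g"
    show "f = g"
    proof (rule poly_mapping_eqI)
      fix k
      show "Poly_Mapping.lookup f k = Poly_Mapping.lookup g k"
      proof (cases "k \<in> A")
        case True
        then show ?thesis using fun_cong[OF fg(3), of k] by simp
      next
        case False
        then have "k \<notin> Poly_Mapping.keys f" "k \<notin> Poly_Mapping.keys g" using fg T by auto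
        then show ?thesis by (simp add: in_keys_iff)
      qed
    qed
  qed
  have sub: "?\<phi> ` T \<subseteq> Pi\<^sub>E A B" using T by (auto simp: PiE_iff)
  have fin: "finite (Pi\<^sub>E A B)" using assms by (intro finite_PiE)
  show "finite T" using inj sub fin by (rule inj_on_finite)
  show "card T \<le> (\<Prod>k\<in>A. card (B k))"
    using card_inj_on_le[OF inj sub fin] card_PiE[OF assms(1), of B] by simp
qed

lemma card_monoms_in_box:
  assumes "finite V"
  shows "finite (monoms_in_box V e)" "card (monoms_in_box V e) \<le> (\<Prod>i\<in>V. e i + 1)"
  using poly_mapping_box_card[of V "\<lambda>i. {0..e i}" "monoms_in_box V e"] assms
  by (auto simp: monoms_in_box_def)

lemma card_polys_in_box:
  assumes "finite V"
  shows "finite (polys_in_box V e M)"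
    "card (polys_in_box V e M) \<le> (2 * M + 1) ^ (\<Prod>i\<in>V. e i + 1)"
proof -
  note fin = card_monoms_in_box(1)[OF assms, of e]
  have sub: "polys_in_box V e M \<subseteq> {f. Poly_Mapping.keys f \<subseteq> monoms_in_box V e \<and>
      (\<forall>k\<in>monoms_in_box V e. Poly_Mapping.lookup f k \<in> {- int M..int M})}"
    unfolding polys_in_box_def by (auto simp: abs_le_iff)
  show "finite (polys_in_box V e M)"
    by (rule poly_mapping_box_card(1)[OF fin _ sub]) simp
  have "nat (2 * int M + 1) = 2 * M + 1" by simp
  then have "card (polys_in_box V e M) \<le> (2 * M + 1) ^ card (monoms_in_box V e)"
    using poly_mapping_box_card(2)[OF fin _ sub] by simp
  also have "\<dots> \<le> (2 * M + 1) ^ (\<Prod>i\<in>V. e i + 1)"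
    by (intro power_increasing card_monoms_in_box(2) assms) simp
  finally show "card (polys_in_box V e M) \<le> (2 * M + 1) ^ (\<Prod>i\<in>V. e i + 1)" .
qed

lemma mem_polys_in_box_self:
  assumes "vars F \<subseteq> V"
  shows "F \<in> polys_in_box V (\<lambda>i. degree_in i F) (height F)"
proof -
  have "Poly_Mapping.lookup m i \<le> degree_in i F" if "m \<in> Poly_Mapping.keys F" for m i
    unfolding degree_in_def using that by (intro Max_ge) auto
  moreover have "\<bar>Poly_Mapping.lookup F m\<bar> \<le> int (height F)" for m
  proof (cases "m \<in> Poly_Mapping.keys F")
    case True
    then have "nat \<bar>Poly_Mapping.lookup F m\<bar> \<le> height F"
      unfolding height_def by (intro Max_ge) auto
    then show ?thesis by linarith
  qed (simp add: in_keys_iff)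
  ultimately show ?thesis
    using assms unfolding polys_in_box_def monoms_in_box_def vars_def by blast
qed

lemma degree_in_height_pos:
  assumes "i \<in> vars F"
  shows "degree_in i F \<ge> 1" "height F \<ge> 1"
proof -
  obtain m where m: "m \<in> Poly_Mapping.keys F" "i \<in> Poly_Mapping.keys m"
    using assms unfolding vars_def by blast
  have F: "F \<in> polys_in_box (vars F) (\<lambda>i. degree_in i F) (height F)"
    by (rule mem_polys_in_box_self) simp
  then have "m \<in> monoms_in_box (vars F) (\<lambda>i. degree_in i F)" using m unfolding polys_in_box_def by blast
  then have "Poly_Mapping.lookup m i \<le> degree_in i F" "\<bar>Poly_Mapping.lookup F m\<bar> \<le> int (height F)"
    using F assms unfolding polys_in_box_def by (auto simp: monoms_in_box_def)
  moreover have "Poly_Mapping.lookup m i \<noteq> 0" "Poly_Mapping.lookup F m \<noteq> 0"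
    using m by (simp_all add: in_keys_iff)
  ultimately show "degree_in i F \<ge> 1" "height F \<ge> 1" by linarith+
qed

lemma vars_polys_in_box: "F \<in> polys_in_box V e M \<Longrightarrow> vars F \<subseteq> V"
  unfolding polys_in_box_def monoms_in_box_def vars_def by blast

lemma single_in_polys_in_box:
  "m \<in> monoms_in_box V e \<Longrightarrow> \<bar>c\<bar> \<le> int M \<Longrightarrow> Poly_Mapping.single m c \<in> polys_in_box V e M"
  unfolding polys_in_box_def by (auto simp: lookup_single when_def)

lemma zero_in_polys_in_box: "0 \<in> polys_in_box V e M"
  unfolding polys_in_box_def by auto

lemma zero_in_monoms_in_box: "0 \<in> monoms_in_box V e"
  unfolding monoms_in_box_def by auto

lemma Var_in_polys_in_box:
  assumes "i \<in> V" "e i \<ge> 1" "M \<ge> 1"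
  shows "Var i \<in> polys_in_box V e M"
  unfolding Var_def using assms
  by (intro single_in_polys_in_box) (auto simp: monoms_in_box_def lookup_single when_def)

text \<open>
  On the box of polynomials, respecting those sums and products that stay in the box is already
  enough to be an evaluation. Every element of the box can be built from the variables without
  leaving it: powers of a variable by repeated multiplication, monomials by multiplying such
  powers, positive multiples of a monomial by repeated addition, negative ones because the sum
  with the opposite multiple is \<open>0\<close>, and polynomials by adding up their terms.
\<close>

lemma partial_hom_eq_mpoly_eval:
  fixes u :: "int_mpoly \<Rightarrow> 'a::comm_ring_1"
  assumes e: "\<And>i. i \<in> V \<Longrightarrow> e i \<ge> 1" and M: "M \<ge> 1"
    and one: "u 1 = 1"
    and add: "\<And>F G. F \<in> polys_in_box V e M \<Longrightarrow> G \<in> polys_in_box V e M \<Longrightarrow>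
      F + G \<in> polys_in_box V e M \<Longrightarrow> u (F + G) = u F + u G"
    and mult: "\<And>F G. F \<in> polys_in_box V e M \<Longrightarrow> G \<in> polys_in_box V e M \<Longrightarrow>
      F * G \<in> polys_in_box V e M \<Longrightarrow> u (F * G) = u F * u G"
    and F: "F \<in> polys_in_box V e M"
  shows "u F = mpoly_eval (\<lambda>i. u (Var i)) F"
proof -
  let ?x = "\<lambda>i. u (Var i)"
  let ?T = "polys_in_box V e M"
  \<comment> \<open>The equation \<open>0 + 0 = 0\<close> lies in the box and leaves \<open>u 0\<close> no other value.\<close>
  have zero: "u 0 = 0"
    using add[of 0 0] by (simp add: zero_in_polys_in_box)
  have mon: "Poly_Mapping.single m 1 \<in> ?T" if "m \<in> monoms_in_box V e" for m
    using that M by (intro single_in_polys_in_box) auto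
  have pow: "u (Poly_Mapping.single (Poly_Mapping.single i n) 1) = u (Var i) ^ n"
    if "i \<in> V" "n \<le> e i" for i n
    using that(2)
  proof (induction n)
    case 0
    then show ?case by (simp add: one)
  next
    case (Suc n)
    have eq: "Poly_Mapping.single (Poly_Mapping.single i (Suc n)) 1 =
        Var i * Poly_Mapping.single (Poly_Mapping.single i n) (1::int)"
      by (simp add: Var_def mult_single single_add[symmetric])
    have in_box: "Poly_Mapping.single (Poly_Mapping.single i k) 1 \<in> ?T" if "k \<le> e i" for k
      using that \<open>i \<in> V\<close> by (intro mon) (auto simp: monoms_in_box_def lookup_single when_def)
    have "u (Var i * Poly_Mapping.single (Poly_Mapping.single i n) 1) =
        u (Var i) * u (Poly_Mapping.single (Poly_Mapping.single i n) 1)"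
      using in_box[of n] in_box[of "Suc n"] Suc.prems \<open>i \<in> V\<close> e M
      by (intro mult) (auto simp: Var_in_polys_in_box eq)
    then show ?case using Suc by (simp add: eq)
  qed
  have monom: "u (Poly_Mapping.single m 1) = monom_eval ?x m" if "m \<in> monoms_in_box V e" for m
    using that
  proof (induction m rule: poly_mapping_induct_disjoint)
    case zero
    then show ?case by (simp add: one monom_eval_def)
  next
    case (add m i n)
    have i: "i \<in> V" "n \<le> e i" and m: "m \<in> monoms_in_box V e"
      and n: "Poly_Mapping.single i n \<in> monoms_in_box V e"
      using add.prems add.hyps unfolding monoms_in_box_def
      by (auto simp: keys_add_single_disjoint lookup_add_single_disjoint lookup_single when_def
          in_keys_iff split: if_splits)
    have "u (Poly_Mapping.single m 1 * Poly_Mapping.single (Poly_Mapping.single i n) 1) =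
        u (Poly_Mapping.single m 1) * u (Poly_Mapping.single (Poly_Mapping.single i n) 1)"
      using mon[OF m] mon[OF n] mon[OF add.prems] by (intro mult) (auto simp: mult_single)
    then show ?case
      using add.IH[OF m] pow[OF i] add.hyps
      by (simp add: mult_single monom_eval_add monom_eval_single)
  qed
  have pos: "u (Poly_Mapping.single m (int n)) = of_nat n * monom_eval ?x m"
    if "m \<in> monoms_in_box V e" "n \<le> M" for m n
    using that(2)
  proof (induction n)
    case 0
    then show ?case by (simp add: zero)
  next
    case (Suc n)
    have eq: "Poly_Mapping.single m (int (Suc n)) = Poly_Mapping.single m 1 + Poly_Mapping.single m (int n)"
      by (simp add: single_add[symmetric])
    have "u (Poly_Mapping.single m 1 + Poly_Mapping.single m (int n)) =
        u (Poly_Mapping.single m 1) + u (Poly_Mapping.single m (int n))"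
      using Suc.prems that(1) unfolding eq[symmetric]
      by (subst eq, intro add) (auto simp: eq[symmetric] intro!: single_in_polys_in_box)
    then show ?case using Suc monom[OF that(1)] unfolding eq by (simp add: algebra_simps)
  qed
  have monomial_term: "u (Poly_Mapping.single m c) = of_int c * monom_eval ?x m"
    if m: "m \<in> monoms_in_box V e" and c: "\<bar>c\<bar> \<le> int M" for m c
  proof (cases "c \<ge> 0")
    case True
    then show ?thesis using pos[OF m, of "nat c"] c by simp
  next
    case False
    have cancel: "Poly_Mapping.single m c + Poly_Mapping.single m (int (nat (- c))) = 0"
      using False by (simp add: single_add[symmetric])
    have "u (Poly_Mapping.single m c + Poly_Mapping.single m (int (nat (- c)))) =
        u (Poly_Mapping.single m c) + u (Poly_Mapping.single m (int (nat (- c))))"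
    proof (rule add)
      show "Poly_Mapping.single m c + Poly_Mapping.single m (int (nat (- c))) \<in> ?T"
        unfolding cancel by (rule zero_in_polys_in_box)
    qed (use m c in \<open>auto simp: zero_in_polys_in_box intro!: single_in_polys_in_box\<close>)
    then have "u (Poly_Mapping.single m c) + of_nat (nat (- c)) * monom_eval ?x m = 0"
      using pos[OF m, of "nat (- c)"] c False unfolding cancel zero by simp
    moreover have "(of_nat (nat (- c)) :: 'a) = - of_int c"
    proof -
      have "(of_nat (nat (- c)) :: 'a) = of_int (int (nat (- c)))"
        by (rule of_int_of_nat_eq[symmetric])
      also have "int (nat (- c)) = - c" using False by simp
      finally show ?thesis by simp
    qed
    ultimately show ?thesis by (simp add: add_eq_0_iff2)
  qed
  show ?thesis using F
  proof (induction F rule: poly_mapping_induct_disjoint)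
    case zero
    then show ?case by (simp add: \<open>u 0 = 0\<close>)
  next
    case (add F m c)
    have F: "F \<in> ?T" and m: "m \<in> monoms_in_box V e" and c: "\<bar>c\<bar> \<le> int M"
      using add.prems add.hyps unfolding polys_in_box_def
      by (auto simp: keys_add_single_disjoint lookup_add_single_disjoint in_keys_iff split: if_splits)
    have "u (F + Poly_Mapping.single m c) = u F + u (Poly_Mapping.single m c)"
      using F m c add.prems by (intro assms(4) single_in_polys_in_box)
    then show ?case using add.IH[OF F] monomial_term[OF m c] by (simp add: mpoly_eval_add mpoly_eval_single)
  qed
qed

section \<open>The bound for integer zeros\<close>

definition integer_zeros :: "nat \<Rightarrow> int_mpoly \<Rightarrow> (nat \<Rightarrow> int) set" where
  "integer_zeros r F = {x \<in> {1..r} \<rightarrow>\<^sub>E UNIV. mpoly_eval x F = 0}"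

text \<open>
  A variable that does not occur can be changed freely in a zero, which gives infinitely many.
  Hence a polynomial with finitely many zeros, but at least one, has positive degree in each
  variable, and the box that it spans contains all the variables.
\<close>

lemma vars_of_finite_integer_zeros:
  assumes "finite (integer_zeros r F)" "x \<in> integer_zeros r F"
  shows "{1..r} \<subseteq> vars F"
proof
  fix i assume i: "i \<in> {1..r}"
  show "i \<in> vars F"
  proof (rule ccontr)
    assume "i \<notin> vars F"
    then have "mpoly_eval (x(i := t)) F = mpoly_eval x F" for t
      by (intro mpoly_eval_cong) auto
    then have "range (\<lambda>t. x(i := t)) \<subseteq> integer_zeros r F"
      using assms(2) i by (auto simp: integer_zeros_def PiE_iff extensional_def)
    then have "finite (range (\<lambda>t. x(i := t)))" using assms(1) finite_subset by blast
    moreover have "inj (\<lambda>t. x(i := t))" by (rule injI) (metis fun_upd_same)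
    ultimately show False using finite_imageD infinite_UNIV_int by blast
  qed
qed

text \<open>
  One unknown for each polynomial in \<open>T\<close>, with \<open>h\<close> giving its index. The equations record the unit,
  every sum and product that stays in \<open>T\<close>, and \<open>F = 0\<close> in the form \<open>F + F = F\<close>.
\<close>

definition box_system :: "(int_mpoly \<Rightarrow> nat) \<Rightarrow> int_mpoly set \<Rightarrow> int_mpoly \<Rightarrow> equation set" where
  "box_system h T F = {One (h 1), Add (h F) (h F) (h F)} \<union>
    {Add (h G) (h H) (h (G + H)) |G H. G \<in> T \<and> H \<in> T \<and> G + H \<in> T} \<union>
    {Mul (h G) (h H) (h (G * H)) |G H. G \<in> T \<and> H \<in> T \<and> G * H \<in> T}"

lemma satisfies_box_system:
  "(\<forall>e\<in>box_system h T F. satisfies y e) \<longleftrightarrow> y (h 1) = 1 \<and> y (h F) = 0 \<and>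
    (\<forall>G\<in>T. \<forall>H\<in>T. G + H \<in> T \<longrightarrow> y (h (G + H)) = y (h G) + y (h H)) \<and>
    (\<forall>G\<in>T. \<forall>H\<in>T. G * H \<in> T \<longrightarrow> y (h (G * H)) = y (h G) * y (h H))"
  (is "?L \<longleftrightarrow> ?R")
proof
  assume L: ?L
  have "satisfies y (One (h 1))" "satisfies y (Add (h F) (h F) (h F))"
    using L unfolding box_system_def by blast+
  moreover have "satisfies y (Add (h G) (h H) (h (G + H)))" if "G \<in> T" "H \<in> T" "G + H \<in> T" for G H
    using L that unfolding box_system_def by blast
  moreover have "satisfies y (Mul (h G) (h H) (h (G * H)))" if "G \<in> T" "H \<in> T" "G * H \<in> T" for G H
    using L that unfolding box_system_def by blast
  ultimately show ?R by simp
next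
  assume ?R
  then show ?L unfolding box_system_def by auto
qed

text \<open>
  Use the system for the box spanned by \<open>F\<close>, all polynomials whose height and degrees do not exceed those
  of \<open>F\<close>. A solution of the system is a partial homomorphism on the box, hence the evaluation at
  the point formed by its values on the variables, and that point is a zero of \<open>F\<close>; conversely
  every zero of \<open>F\<close> gives a solution by evaluation. So the system has finitely many solutions, and
  the conjecture bounds the values of the unknowns that stand for the variables. The number of
  unknowns is the size of the box, which is estimated in \<open>card_polys_in_box\<close>.
\<close>

theorem integer_zeros_bounded:
  assumes T: conjecture_T
    and vars: "vars F \<subseteq> {1..r}"
    and fin: "finite (integer_zeros r F)"
    and x: "x \<in> integer_zeros r F" and i: "i \<in> {1..r}"
  shows "\<bar>x i\<bar> \<le> int (bound r F)"
proof -
  let ?V = "{1..r}"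
  define e where "e = (\<lambda>j. degree_in j F)"
  define M where "M = height F"
  define P where "P = polys_in_box ?V e M"
  define n where "n = card P"
  have e: "e j \<ge> 1" if "j \<in> ?V" for j
    unfolding e_def using vars_of_finite_integer_zeros[OF fin x] that by (intro degree_in_height_pos) auto
  have M: "M \<ge> 1"
    unfolding M_def using vars_of_finite_integer_zeros[OF fin x] i by (intro degree_in_height_pos) auto
  have F: "F \<in> P" unfolding P_def e_def M_def using vars by (rule mem_polys_in_box_self)
  have one: "1 \<in> P"
    using single_in_polys_in_box[OF zero_in_monoms_in_box, of 1 M ?V e] M unfolding P_def by simp
  have Var: "Var j \<in> P" if "j \<in> ?V" for j
    unfolding P_def using that e M by (intro Var_in_polys_in_box) auto
  have finP: "finite P" unfolding P_def by (rule card_polys_in_box) simp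
  obtain h where h: "bij_betw h P {1..n}"
    unfolding n_def using ex_bij_betw_nat_finite_1 finP finite_same_card_bij
    by (metis card_atLeastAtMost diff_Suc_1 finite_atLeastAtMost)
  define g where "g = inv_into P h"
  have hP: "h G \<in> {1..n}" if "G \<in> P" for G using h that by (rule bij_betwE[rule_format])
  have gP: "g k \<in> P" "h (g k) = k" if "k \<in> {1..n}" for k
    using h that unfolding g_def by (auto simp: bij_betw_def inv_into_into f_inv_into_f)
  have gh: "g (h G) = G" if "G \<in> P" for G
    using h that unfolding g_def by (auto simp: bij_betw_def)
  define S where "S = box_system h P F"
  have S: "S \<subseteq> E n"
    using hP one F unfolding S_def box_system_def E_def by auto
  \<comment> \<open>\<open>\<Phi>\<close> sends a solution of the system to the zero of \<open>F\<close> that it evaluates at.\<close>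
  define \<Phi> where "\<Phi> y = restrict (\<lambda>j. y (h (Var j))) ?V" for y :: "nat \<Rightarrow> int"
  have sol: "y (h G) = mpoly_eval (\<Phi> y) G" if y: "y \<in> solutions n S" and G: "G \<in> P" for y G
  proof -
    have sat: "\<forall>eq\<in>box_system h P F. satisfies y eq" using y unfolding solutions_def S_def by blast
    have "y (h G) = mpoly_eval (\<lambda>j. y (h (Var j))) G"
      using e M sat[unfolded satisfies_box_system] G unfolding P_def
      by (intro partial_hom_eq_mpoly_eval[where u = "\<lambda>G. y (h G)" and V = ?V and e = e and M = M]) auto
    also have "\<dots> = mpoly_eval (\<Phi> y) G"
      using vars_polys_in_box[OF G[unfolded P_def]] unfolding \<Phi>_def
      by (intro mpoly_eval_cong) auto
    finally show ?thesis .
  qed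
  have "\<Phi> ` solutions n S \<subseteq> integer_zeros r F"
  proof
    fix z assume "z \<in> \<Phi> ` solutions n S"
    then obtain y where y: "y \<in> solutions n S" "z = \<Phi> y" by blast
    have "\<forall>eq\<in>box_system h P F. satisfies y eq" using y unfolding solutions_def S_def by blast
    then have "mpoly_eval z F = 0" using sol[OF y(1) F] y(2) unfolding satisfies_box_system by simp
    then show "z \<in> integer_zeros r F" unfolding integer_zeros_def y(2) \<Phi>_def by simp
  qed
  \<comment> \<open>Every unknown stands for a polynomial, whose value is determined by the point.\<close>
  moreover have "inj_on \<Phi> (solutions n S)"
  proof (rule inj_onI)
    fix y z assume yz: "y \<in> solutions n S" "z \<in> solutions n S" "\<Phi> y = \<Phi> z"
    have "y k = z k" if "k \<in> {1..n}" for k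
      using sol[OF yz(1) gP(1)[OF that]] sol[OF yz(2) gP(1)[OF that]] yz(3) gP(2)[OF that] by simp
    then show "y = z" using yz(1,2) unfolding solutions_def by (intro PiE_ext[of y "{1..n}" _ z]) auto
  qed
  ultimately have "finite (solutions n S)" using fin by (metis inj_on_finite)
  \<comment> \<open>The given zero \<open>x\<close>, extended to all polynomials in the box.\<close>
  moreover define y where "y = restrict (\<lambda>k. mpoly_eval x (g k)) {1..n}"
  have y: "y (h G) = mpoly_eval x G" if "G \<in> P" for G
    using hP[OF that] gh[OF that] unfolding y_def by simp
  have "\<forall>eq\<in>S. satisfies y eq"
    using x one F unfolding S_def satisfies_box_system integer_zeros_def
    by (auto simp: y mpoly_eval_add mpoly_eval_mult)
  then have "y \<in> solutions n S" unfolding solutions_def y_def by auto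
  moreover have "n \<ge> 1" using F finP unfolding n_def by (metis One_nat_def Suc_leI card_gt_0_iff empty_iff)
  moreover note hP[OF Var[OF i]]
  ultimately have "\<bar>y (h (Var i))\<bar> \<le> 2 ^ (2 ^ (n - 1))"
    using T S unfolding conjecture_T_def by blast
  then have "\<bar>x i\<bar> \<le> 2 ^ (2 ^ (n - 1))" using y[OF Var[OF i]] by simp
  also have "\<dots> \<le> 2 ^ (2 ^ ((2 * M + 1) ^ (\<Prod>j\<in>?V. e j + 1) - 1))"
    unfolding n_def P_def by (intro power_increasing diff_le_mono card_polys_in_box) auto
  also have "\<dots> = int (bound r F)" unfolding bound_def e_def M_def by simp
  finally show ?thesis .
qed

section \<open>From non-negative zeros to integer zeros\<close>

lemma mpoly_eval_D_hat:
  "mpoly_eval y (D_hat p D) = (mpoly_eval (\<lambda>i. y (5 * i - 4)) D)\<^sup>2 +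
    (\<Sum>i=1..p. (y (5 * i - 4) - (y (5 * i - 3))\<^sup>2 - (y (5 * i - 2))\<^sup>2
      - (y (5 * i - 1))\<^sup>2 - (y (5 * i))\<^sup>2)\<^sup>2)"
  unfolding D_hat_def
  by (simp add: mpoly_eval_add mpoly_eval_sum mpoly_eval_power mpoly_eval_diff mpoly_eval_substitute)

lemma mpoly_eval_D_hat_eq_0_iff:
  fixes y :: "nat \<Rightarrow> int"
  shows "mpoly_eval y (D_hat p D) = 0 \<longleftrightarrow> mpoly_eval (\<lambda>i. y (5 * i - 4)) D = 0 \<and>
    (\<forall>i\<in>{1..p}. y (5 * i - 4) =
      (y (5 * i - 3))\<^sup>2 + (y (5 * i - 2))\<^sup>2 + (y (5 * i - 1))\<^sup>2 + (y (5 * i))\<^sup>2)"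
proof -
  have "a - b - c - d - f = 0 \<longleftrightarrow> a = b + c + d + f" for a b c d f :: int by linarith
  then show ?thesis
    unfolding mpoly_eval_D_hat
    by (subst add_nonneg_eq_0_iff) (auto simp: sum_nonneg sum_nonneg_eq_0_iff)
qed

lemma vars_D_hat:
  assumes "vars D \<subseteq> {1..p}"
  shows "vars (D_hat p D) \<subseteq> {1..5 * p}"
proof -
  have "vars (mpoly_eval (\<lambda>i. Var (5 * i - 4)) D) \<subseteq> {1..5 * p}"
    by (rule order_trans[OF vars_substitute]) (use assms in fastforce)
  then have 1: "vars (mpoly_eval (\<lambda>i. Var (5 * i - 4)) D ^ 2) \<subseteq> {1..5 * p}"
    using vars_power by blast
  have 2: "vars ((Var (5 * i - 4) - Var (5 * i - 3) ^ 2 - Var (5 * i - 2) ^ 2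
      - Var (5 * i - 1) ^ 2 - Var (5 * i) ^ 2) ^ 2) \<subseteq> {1..5 * p}" (is "vars (?Q ^ 2) \<subseteq> _")
    if "i \<in> {1..p}" for i
  proof -
    have pow: "vars (Var k ^ 2) \<subseteq> {k}" for k using vars_power[of "Var k" 2] by simp
    have "vars ?Q \<subseteq> {5 * i - 4, 5 * i - 3, 5 * i - 2, 5 * i - 1, 5 * i}"
      by (intro order_trans[OF vars_diff] Un_least order_trans[OF pow]) auto
    also have "\<dots> \<subseteq> {1..5 * p}" using that by auto
    finally show ?thesis using vars_power[of ?Q 2] by blast
  qed
  show ?thesis
    unfolding D_hat_def
    by (intro order_trans[OF vars_add] Un_least 1 order_trans[OF vars_sum] UN_least 2)
qed

text \<open>
  The numbers \<open>x\<^sub>i\<close> in a zero form a non-negative zero of \<open>D\<close>, so finitely many values are possible,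
  and each square in a sum of squares equal to \<open>x\<^sub>i\<close> is at most \<open>x\<^sub>i\<close>. All coordinates therefore lie
  in a fixed interval.
\<close>

lemma finite_integer_zeros_D_hat:
  assumes vars: "vars D \<subseteq> {1..p}" and fin: "finite (nonneg_zeros p D)"
  shows "finite (integer_zeros (5 * p) (D_hat p D))"
proof -
  define W where "W = (\<Union>x\<in>nonneg_zeros p D. x ` {1..p})"
  have "finite W" unfolding W_def using fin by blast
  then have W_le: "v \<le> Max W" if "v \<in> W" for v using that by simp
  define B where "B = Max W"
  have "integer_zeros (5 * p) (D_hat p D) \<subseteq> {1..5 * p} \<rightarrow>\<^sub>E {- B..B}"
  proof (intro subsetI PiE_I)
    fix y k assume y: "y \<in> integer_zeros (5 * p) (D_hat p D)"
    then have D: "mpoly_eval (\<lambda>i. y (5 * i - 4)) D = 0"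
      and sq: "\<And>i. i \<in> {1..p} \<Longrightarrow> y (5 * i - 4) =
        (y (5 * i - 3))\<^sup>2 + (y (5 * i - 2))\<^sup>2 + (y (5 * i - 1))\<^sup>2 + (y (5 * i))\<^sup>2"
      unfolding integer_zeros_def mpoly_eval_D_hat_eq_0_iff by auto
    show "k \<notin> {1..5 * p} \<Longrightarrow> y k = undefined"
      using y unfolding integer_zeros_def by (auto simp: PiE_iff extensional_def)
    let ?x = "restrict (\<lambda>i. y (5 * i - 4)) {1..p}"
    have "mpoly_eval ?x D = mpoly_eval (\<lambda>i. y (5 * i - 4)) D"
      using vars by (intro mpoly_eval_cong) auto
    then have "?x \<in> nonneg_zeros p D"
      using D sq unfolding nonneg_zeros_def by (auto simp: PiE_iff)
    then have "?x i \<in> W" if "i \<in> {1..p}" for i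
      using that unfolding W_def by blast
    then have le: "y (5 * i - 4) \<le> B" if "i \<in> {1..p}" for i
      using W_le that unfolding B_def by fastforce
    assume k: "k \<in> {1..5 * p}"
    \<comment> \<open>The variable \<open>k\<close> belongs to the \<open>i\<close>-th group of five.\<close>
    define i where "i = (k + 4) div 5"
    have i: "i \<in> {1..p}" using k unfolding i_def by auto
    have "k = 5 * i - 4 \<or> k = 5 * i - 3 \<or> k = 5 * i - 2 \<or> k = 5 * i - 1 \<or> k = 5 * i"
      using k unfolding i_def by auto
    moreover have "0 \<le> y (5 * i - 4)" unfolding sq[OF i] by simp
    moreover have "(y j)\<^sup>2 \<le> y (5 * i - 4)"
      if "j = 5 * i - 3 \<or> j = 5 * i - 2 \<or> j = 5 * i - 1 \<or> j = 5 * i" for j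
      using that by (elim disjE) (simp_all add: sq[OF i])
    ultimately have "(y k)\<^sup>2 \<le> y (5 * i - 4) \<or> y k = y (5 * i - 4)"
      by blast
    moreover have "\<bar>y k\<bar> \<le> (y k)\<^sup>2"
    proof (cases "y k = 0")
      case False
      then have "\<bar>y k\<bar> * 1 \<le> \<bar>y k\<bar> * \<bar>y k\<bar>" by (intro mult_left_mono) auto
      then show ?thesis by (simp add: power2_eq_square)
    qed simp
    ultimately have "\<bar>y k\<bar> \<le> y (5 * i - 4)"
      using \<open>0 \<le> y (5 * i - 4)\<close> by auto
    then show "y k \<in> {- B..B}" using le[OF i] by auto
  qed
  then show ?thesis by (rule finite_subset) (intro finite_PiE; simp)
qed

text \<open>
  By the four-square theorem each \<open>x\<^sub>i\<close> supplies values for \<open>a\<^sub>i, b\<^sub>i, c\<^sub>i, d\<^sub>i\<close>.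
\<close>

lemma nonneg_zero_lifts_to_D_hat:
  assumes vars: "vars D \<subseteq> {1..p}" and x: "x \<in> nonneg_zeros p D"
  obtains y where "y \<in> integer_zeros (5 * p) (D_hat p D)"
    "\<And>i. i \<in> {1..p} \<Longrightarrow> y (5 * i - 4) = x i"
proof -
  have "\<exists>f :: nat \<Rightarrow> int. f 0 = x i \<and> x i = (f 1)\<^sup>2 + (f 2)\<^sup>2 + (f 3)\<^sup>2 + (f 4)\<^sup>2"
    if "i \<in> {1..p}" for i
  proof -
    have "x i \<ge> 0" using x that unfolding nonneg_zeros_def by (auto simp: PiE_iff)
    then obtain a b c d where "x i = a\<^sup>2 + b\<^sup>2 + c\<^sup>2 + d\<^sup>2"
      using lagrange_four_squares unfolding sum_of_four_squares_def by blast
    \<comment> \<open>The values in the \<open>i\<close>-th group of five, listed from position \<open>0\<close>.\<close>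
    then show ?thesis by (intro exI[of _ "nth [x i, a, b, c, d]"]) (simp add: eval_nat_numeral)
  qed
  then obtain f :: "nat \<Rightarrow> nat \<Rightarrow> int" where f: "\<And>i. i \<in> {1..p} \<Longrightarrow> f i 0 = x i"
    "\<And>i. i \<in> {1..p} \<Longrightarrow> x i = (f i 1)\<^sup>2 + (f i 2)\<^sup>2 + (f i 3)\<^sup>2 + (f i 4)\<^sup>2"
    by metis
  define y where "y = restrict (\<lambda>k. f ((k + 4) div 5) ((k + 4) mod 5)) {1..5 * p}"
  have y: "y (5 * i - 4 + s) = f i s" if "i \<in> {1..p}" "s \<le> 4" for i s
  proof -
    have "(5 * i - 4 + s + 4) div 5 = i" "(5 * i - 4 + s + 4) mod 5 = s" "5 * i - 4 + s \<in> {1..5 * p}"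
      using that by auto
    then show ?thesis unfolding y_def by simp
  qed
  have yi: "y (5 * i - 4) = f i 0" "y (5 * i - 3) = f i 1" "y (5 * i - 2) = f i 2"
    "y (5 * i - 1) = f i 3" "y (5 * i) = f i 4" if i: "i \<in> {1..p}" for i
  proof -
    have "5 * i - 3 = 5 * i - 4 + 1" "5 * i - 2 = 5 * i - 4 + 2" "5 * i - 1 = 5 * i - 4 + 3"
      "5 * i = 5 * i - 4 + 4" using i by auto
    then show "y (5 * i - 4) = f i 0" "y (5 * i - 3) = f i 1" "y (5 * i - 2) = f i 2"
      "y (5 * i - 1) = f i 3" "y (5 * i) = f i 4"
      using y[OF i, of 0] y[OF i, of 1] y[OF i, of 2] y[OF i, of 3] y[OF i, of 4] by simp_all
  qed
  have "mpoly_eval (\<lambda>i. y (5 * i - 4)) D = mpoly_eval x D"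
    using vars yi f(1) by (intro mpoly_eval_cong) auto
  then have "mpoly_eval y (D_hat p D) = 0"
    using x yi f unfolding mpoly_eval_D_hat_eq_0_iff nonneg_zeros_def by simp
  moreover have "y \<in> {1..5 * p} \<rightarrow>\<^sub>E UNIV" unfolding y_def by simp
  ultimately show ?thesis using that[of y] yi f(1) unfolding integer_zeros_def by simp
qed

theorem theorem6:
  fixes p :: nat and D :: int_mpoly
  assumes "conjecture_T"
    and "p \<ge> 1"
    and "vars D \<subseteq> {1..p}"
    and "finite (nonneg_zeros p D)"
  shows "\<forall>x\<in>nonneg_zeros p D. \<forall>i\<in>{1..p}. x i \<le> int (bound (5 * p) (D_hat p D))"
proof (intro ballI)
  fix x i assume x: "x \<in> nonneg_zeros p D" and i: "i \<in> {1..p}"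
  obtain y where y: "y \<in> integer_zeros (5 * p) (D_hat p D)" "y (5 * i - 4) = x i"
    using nonneg_zero_lifts_to_D_hat[OF assms(3) x] i by metis
  have "5 * i - 4 \<in> {1..5 * p}" using i by auto
  then have "\<bar>y (5 * i - 4)\<bar> \<le> int (bound (5 * p) (D_hat p D))"
    using assms(1) vars_D_hat[OF assms(3)] finite_integer_zeros_D_hat[OF assms(3,4)] y(1)
    by (intro integer_zeros_bounded)
  then show "x i \<le> int (bound (5 * p) (D_hat p D))" using y(2) by simp
qed

end
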